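(* Assume the Axiom of Choice. There is no topology $\tau$ on $\mathbb{R}$ such that $C(\tau)=\mathcal{C}_{\mathbb{Q}}$, and there is no topology $\tau$ on $\mathbb{R}$ such that $C(\tau)=\mathcal{C}_{\mathrm{bi}\mathbb{Q}}$.
   Context: The Axiom of Choice is assumed in addition to ZF. For a topology $\tau$ on $\mathbb{R}$, $C(\tau)$ is the set of functions $f:\mathbb{R}\to\mathbb{R}$ that are continuous as maps from $(\mathbb{R},\tau)$ to $\mathbb{R}$ with the usual Euclidean topology. $\mathcal{C}_{\mathbb{Q}}$ is the set of all $\mathbb{Q}$-continuous functions $\mathbb{R}\to\mathbb{R}$ and $\mathcal{C}_{\mathrm{bi}\mathbb{Q}}$ the set of all bilaterally $\mathbb{Q}$-continuous functions $\mathbb{R}\to\mathbb{R}$, defined as follows. For real $y\neq z$ put $S(y,z)=\{qy+(1-q)z: q\in\mathbb{Q}\cap[0,1]\}$. $f:\mathbb{R}\to\mathbb{R}$ is $\mathbb{Q}$-continuous at $x$ from the left if there is $\epsilon>0$ such that for all $y,z$ with $x-\epsilon<y<z\le x$ there is a continuous function $f_{y,z}:[y,z]\to\mathbb{R}$ with $f_{y,z}(t)=f(t)$ for all $t\in S(y,z)$; from the right: analogously with $x\le y<z<x+\epsilon$. $f$ is $\mathbb{Q}$-continuous if at every $x\in\mathbb{R}$ it is $\mathbb{Q}$-continuous from both sides. $f$ is bilaterally $\mathbb{Q}$-continuous if for every $x\in\mathbb{R}$ there is $\epsilon>0$ such that for all $y,z$ with $x-\epsilon\le y<z\le x+\epsilon$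 there is a continuous function $f_{y,z}:[y,z]\to\mathbb{R}$ with $f_{y,z}(t)=f(t)$ for all $t\in S(y,z)$. *)

theory Defs
  imports "HOL-Analysis.Analysis"
begin

definition rat_segment :: "real \<Rightarrow> real \<Rightarrow> real set" where
  "rat_segment y z = {q * y + (1 - q) * z | q. q \<in> \<rat> \<inter> {0..1}}"

text \<open>The real function \<open>g\<close> is total; only its values on \<open>{y..z}\<close> matter.\<close>

definition continuously_interpolable :: "(real \<Rightarrow> real) \<Rightarrow> real \<Rightarrow> real \<Rightarrow> bool" where
  "continuously_interpolable f y z \<longleftrightarrow>
     (\<exists>g :: real \<Rightarrow> real. continuous_on {y..z} g \<and> (\<forall>t\<in>rat_segment y z. g t = f t))"

definition Q_continuous_left :: "(real \<Rightarrow> real) \<Rightarrow> real \<Rightarrow> bool" where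
  "Q_continuous_left f x \<longleftrightarrow>
     (\<exists>\<epsilon>>0. \<forall>y z. x - \<epsilon> < y \<and> y < z \<and> z \<le> x \<longrightarrow> continuously_interpolable f y z)"

definition Q_continuous_right :: "(real \<Rightarrow> real) \<Rightarrow> real \<Rightarrow> bool" where
  "Q_continuous_right f x \<longleftrightarrow>
     (\<exists>\<epsilon>>0. \<forall>y z. x \<le> y \<and> y < z \<and> z < x + \<epsilon> \<longrightarrow> continuously_interpolable f y z)"

definition Q_continuous :: "(real \<Rightarrow> real) \<Rightarrow> bool" where
  "Q_continuous f \<longleftrightarrow> (\<forall>x. Q_continuous_left f x \<and> Q_continuous_right f x)"

definition bi_Q_continuous :: "(real \<Rightarrow> real) \<Rightarrow> bool" where
  "bi_Q_continuous f \<longleftrightarrow>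
     (\<forall>x. \<exists>\<epsilon>>0. \<forall>y z. x - \<epsilon> \<le> y \<and> y < z \<and> z \<le> x + \<epsilon> \<longrightarrow> continuously_interpolable f y z)"

definition cont_funs :: "real topology \<Rightarrow> (real \<Rightarrow> real) set" where
  "cont_funs \<tau> = {f. continuous_map \<tau> euclideanreal f}"

end

theory Submission
  imports Defs
begin

text \<open>
  The ring of continuous real functions of a topological space is inverse-closed: the reciprocal
  of a continuous function without zeros is continuous. Neither class of functions in the theorem
  has this property, and one function refutes both. Fix an irrational \<open>\<alpha>\<close> with \<open>0 < \<alpha> < 1\<close>. A
  Hamel basis containing \<open>1\<close> and \<open>\<alpha>\<close> gives a \<open>\<rat>\<close>-linear map \<open>r\<close> from the reals \<^emph>\<open>into the
  rationals\<close> with \<open>r 1 = 1\<close> and \<open>r \<alpha> = 0\<close>.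

  Being \<open>\<rat>\<close>-linear, \<open>r\<close> agrees on every rational segment with an affine function, so \<open>r - \<alpha>\<close> is
  bilaterally \<open>\<rat>\<close>-continuous; since its values are irrational, it has no zeros. On the other hand
  both fibres \<open>r = 0\<close> and \<open>r = 1\<close> are dense, so to the right of \<open>0\<close> and arbitrarily close to it
  there are rational segments that \<open>r\<close> maps onto the rationals of \<open>[0, 1]\<close>, which accumulate at \<open>\<alpha>\<close>.
  On such a segment \<open>1 / (r - \<alpha>)\<close> is unbounded and hence has no continuous extension to the compact
  interval, so \<open>1 / (r - \<alpha>)\<close> is not \<open>\<rat>\<close>-continuous from the right at \<open>0\<close>. The argument
  thus excludes every class of functions between the bilaterally \<open>\<rat>\<close>-continuous and the \<open>\<rat>\<close>-continuous ones.
\<close>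

lemma bi_Q_continuous_imp_Q_continuous:
  assumes "bi_Q_continuous f"
  shows "Q_continuous f"
  unfolding Q_continuous_def
proof (intro allI conjI)
  fix x
  obtain e where e: "e > 0"
    and int: "\<And>y z. x - e \<le> y \<Longrightarrow> y < z \<Longrightarrow> z \<le> x + e \<Longrightarrow> continuously_interpolable f y z"
    using assms unfolding bi_Q_continuous_def by blast
  show "Q_continuous_left f x"
    unfolding Q_continuous_left_def using e by (intro exI[of _ e]) (auto intro!: int)
  show "Q_continuous_right f x"
    unfolding Q_continuous_right_def using e by (intro exI[of _ e]) (auto intro!: int)
qed

definition rat_linear :: "(real \<Rightarrow> real) \<Rightarrow> bool" where
  "rat_linear r \<longleftrightarrow>
     (\<forall>x y. r (x + y) = r x + r y) \<and> (\<forall>q\<in>\<rat>. \<forall>x. r (q * x) = q * r x)"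

text \<open>
  This is where the Axiom of Choice enters: \<open>1\<close> and \<open>\<alpha>\<close> are independent over the rationals, and a
  linear map into the one-dimensional rational space can be prescribed on an independent set.
\<close>

lemma rat_linear_projection_exists:
  fixes \<alpha> :: real
  assumes "\<alpha> \<notin> \<rat>"
  obtains r where "rat_linear r" "range r \<subseteq> \<rat>" "r 1 = 1" "r \<alpha> = 0"
proof -
  interpret vector_space_pair "\<lambda>(q::rat) (x::real). of_rat q * x" "(*) :: rat \<Rightarrow> rat \<Rightarrow> rat"
    by unfold_locales (auto simp: algebra_simps of_rat_add of_rat_mult)
  have "\<alpha> \<noteq> 1"
    using assms by auto
  have "\<alpha> \<notin> vs1.span {1}"
    using assms by (auto simp: vs1.span_singleton)
  then have "vs1.independent {\<alpha>, 1}"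
    by (simp add: vs1.independent_insert)
  then obtain g where g: "Vector_Spaces.linear (\<lambda>(q::rat) (x::real). of_rat q * x) (*) g"
    and vals: "\<forall>x\<in>{\<alpha>, 1}. g x = (if x = 1 then 1 else 0)"
    using linear_independent_extend[of "{\<alpha>, 1}" "\<lambda>x. if x = 1 then 1 else 0"] by blast
  show thesis
  proof (rule that[of "\<lambda>x. of_rat (g x)"])
    show "rat_linear (\<lambda>x. of_rat (g x))"
      unfolding rat_linear_def
      using linear_add[OF g] linear_scale[OF g]
      by (auto simp: of_rat_add of_rat_mult elim!: Rats_cases)
  qed (use vals \<open>\<alpha> \<noteq> 1\<close> in auto)
qed

text \<open>The interpolant is the affine function through the two end points of the segment.\<close>

lemma bi_Q_continuous_rat_linear_diff:
  assumes "rat_linear r"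
  shows "bi_Q_continuous (\<lambda>x. r x - c)"
proof -
  have "continuously_interpolable (\<lambda>x. r x - c) y z" if "y < z" for y z
    unfolding continuously_interpolable_def
  proof (intro exI conjI ballI)
    let ?g = "\<lambda>t. (z - t) / (z - y) * r y + (1 - (z - t) / (z - y)) * r z - c"
    show "continuous_on {y..z} ?g"
      using that by (intro continuous_intros) auto
    fix t assume "t \<in> rat_segment y z"
    then obtain q where q: "q \<in> \<rat>" and t: "t = q * y + (1 - q) * z"
      unfolding rat_segment_def by blast
    have "z - t = q * (z - y)"
      unfolding t by (simp add: algebra_simps)
    then have "(z - t) / (z - y) = q"
      using that by simp
    moreover have "r t = q * r y + (1 - q) * r z"
      using assms q unfolding t rat_linear_def by (metis Rats_1 Rats_diff)
    ultimately show "?g t = r t - c"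
      by simp
  qed
  then show ?thesis
    unfolding bi_Q_continuous_def by (intro allI exI[of _ 1]) auto
qed

text \<open>
  The fibre over \<open>c\<close> contains \<open>c + q * \<alpha>\<close> for every rational \<open>q\<close>: adding multiples of \<open>\<alpha>\<close> moves the
  point without changing its value.
\<close>

lemma rat_linear_fibre_dense:
  assumes "rat_linear r" "r 1 = 1" "r \<alpha> = 0" "\<alpha> > 0" "c \<in> \<rat>" "a < b"
  obtains t where "a < t" "t < b" "r t = c"
proof -
  have "(a - c) / \<alpha> < (b - c) / \<alpha>"
    using assms by (simp add: divide_strict_right_mono)
  then obtain q where q: "q \<in> \<rat>" "(a - c) / \<alpha> < q" "q < (b - c) / \<alpha>"
    using Rats_dense_in_real by blast
  have "r (c * 1 + q * \<alpha>) = c"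
    using assms q(1) unfolding rat_linear_def by (metis add.right_neutral mult.right_neutral mult_zero_right)
  then show thesis
    using that[of "c + q * \<alpha>"] q assms by (simp add: field_simps)
qed

text \<open>
  The image of the segment under \<open>r\<close> contains every rational between \<open>r y\<close> and \<open>r z\<close>, in particular
  rationals so close to \<open>\<alpha>\<close> that the reciprocal exceeds any bound.
\<close>

lemma reciprocal_not_interpolable:
  assumes r: "rat_linear r" "range r \<subseteq> \<rat>" and yz: "y \<le> z"
    and \<alpha>: "r y < \<alpha>" "\<alpha> < r z"
  shows "\<not> continuously_interpolable (\<lambda>x. 1 / (r x - \<alpha>)) y z"
proof
  assume "continuously_interpolable (\<lambda>x. 1 / (r x - \<alpha>)) y z"
  then obtain g where cont: "continuous_on {y..z} g"
    and g: "\<And>t. t \<in> rat_segment y z \<Longrightarrow> g t = 1 / (r t - \<alpha>)"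
    unfolding continuously_interpolable_def by blast
  have "bounded (g ` {y..z})"
    using cont by (intro compact_imp_bounded compact_continuous_image) auto
  then obtain M where M: "M > 0" "\<And>t. t \<in> {y..z} \<Longrightarrow> \<bar>g t\<bar> \<le> M"
    unfolding bounded_pos by auto
  obtain p where p: "p \<in> \<rat>" "\<alpha> < p" "p < min (r z) (\<alpha> + 1 / M)"
    using Rats_dense_in_real[of \<alpha> "min (r z) (\<alpha> + 1 / M)"] \<alpha> M(1) by auto
  define q where "q = (r z - p) / (r z - r y)"
  define t where "t = q * y + (1 - q) * z"
  have q: "q \<in> \<rat>" "0 \<le> q" "q \<le> 1"
    using r(2) p \<alpha> unfolding q_def by (auto intro!: Rats_divide Rats_diff simp: field_simps)
  have "q * (r z - r y) = r z - p"
    using \<alpha> unfolding q_def by simp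
  then have "q * r y + (1 - q) * r z = p"
    by (simp add: algebra_simps)
  then have "r t = p"
    using r(1) q(1) unfolding t_def rat_linear_def by (metis Rats_1 Rats_diff)
  have "t \<in> rat_segment y z"
    using q unfolding t_def rat_segment_def by auto
  moreover have "t \<in> {y..z}"
    using q yz mult_left_le_one_le[of "z - y" q] mult_nonneg_nonneg[of q "z - y"]
    unfolding t_def by (auto simp: algebra_simps)
  ultimately have "1 / (p - \<alpha>) \<le> M"
    using g[of t] M(2)[of t] \<open>r t = p\<close> p(2) by simp
  then show False
    using p M(1) by (simp add: field_simps)
qed

lemma reciprocal_not_Q_continuous:
  assumes r: "rat_linear r" "range r \<subseteq> \<rat>" "r 1 = 1" "r \<alpha> = 0" and \<alpha>: "0 < \<alpha>" "\<alpha> < 1"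
  shows "\<not> Q_continuous (\<lambda>x. 1 / (r x - \<alpha>))"
proof
  assume "Q_continuous (\<lambda>x. 1 / (r x - \<alpha>))"
  then have "Q_continuous_right (\<lambda>x. 1 / (r x - \<alpha>)) 0"
    unfolding Q_continuous_def by blast
  then obtain e where e: "e > 0"
    and int: "\<And>y z. 0 \<le> y \<Longrightarrow> y < z \<Longrightarrow> z < e \<Longrightarrow>
      continuously_interpolable (\<lambda>x. 1 / (r x - \<alpha>)) y z"
    unfolding Q_continuous_right_def by auto
  obtain y where y: "0 < y" "y < e" "r y = 0"
    using rat_linear_fibre_dense[OF r(1,3,4) \<alpha>(1) Rats_0 e] .
  obtain z where z: "y < z" "z < e" "r z = 1"
    using rat_linear_fibre_dense[OF r(1,3,4) \<alpha>(1) Rats_1 y(2)] .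
  show False
    using reciprocal_not_interpolable[OF r(1,2), of y z \<alpha>] int[of y z] y z \<alpha> by simp
qed

lemma cont_funs_reciprocal:
  assumes "f \<in> cont_funs \<tau>" "\<And>x. f x \<noteq> 0"
  shows "(\<lambda>x. 1 / f x) \<in> cont_funs \<tau>"
  using assms unfolding cont_funs_def by (auto intro: continuous_map_real_divide)

theorem no_topology_between_bi_Q_and_Q_continuous:
  assumes "{f. bi_Q_continuous f} \<subseteq> C" "C \<subseteq> {f. Q_continuous f}"
  shows "cont_funs \<tau> \<noteq> C"
proof
  assume C: "cont_funs \<tau> = C"
  have "uncountable ({0<..<1::real} - \<rat>)"
    by (intro uncountable_minus_countable countable_rat) (simp add: uncountable_open_interval)
  then obtain \<alpha> :: real where \<alpha>: "0 < \<alpha>" "\<alpha> < 1" "\<alpha> \<notin> \<rat>"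
    by (metis DiffE countable_empty equals0I greaterThanLessThan_iff)
  obtain r where r: "rat_linear r" "range r \<subseteq> \<rat>" "r 1 = 1" "r \<alpha> = 0"
    using rat_linear_projection_exists[OF \<alpha>(3)] .
  have "(\<lambda>x. r x - \<alpha>) \<in> cont_funs \<tau>"
    using bi_Q_continuous_rat_linear_diff[OF r(1)] assms(1) C by blast
  moreover have "r x - \<alpha> \<noteq> 0" for x
    using r(2) \<alpha>(3) by auto
  ultimately have "(\<lambda>x. 1 / (r x - \<alpha>)) \<in> cont_funs \<tau>"
    by (rule cont_funs_reciprocal)
  then show False
    using reciprocal_not_Q_continuous[OF r \<alpha>(1,2)] assms(2) C by blast
qed

theorem corollary9p16:
  shows "(\<nexists>\<tau> :: real topology. topspace \<tau> = UNIV \<and> cont_funs \<tau> = {f. Q_continuous f}) \<and>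
         (\<nexists>\<tau> :: real topology. topspace \<tau> = UNIV \<and> cont_funs \<tau> = {f. bi_Q_continuous f})"
  using no_topology_between_bi_Q_and_Q_continuous bi_Q_continuous_imp_Q_continuous by blast

end
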